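(* Let $Z_0,\dots,Z_{N-1}$ be independent Bernoulli random variables with $\Pr\{Z_n=0\}=\mathfrak{p}_n$ and $\Pr\{Z_n=1\}=1-\mathfrak{p}_n$. Let the signal-to-noise ratio (SNR) be $\Gamma=\mathcal{G}\sum_{n=0}^{N-1}\mathcal{A}_nZ_n$, where $\mathcal{G}$ is a constant and the $\mathcal{A}_n$ are path coefficients. Restrict $\mathcal{A}_n$ to be fixed for all $N$ paths, i.e. $\mathcal{A}_n\approx\mathcal{A}=\mathbb{E}\{\mathcal{A}_n\}$ for all $n$, and put $$\Gamma_{\mathrm{III}}=\mathcal{G}\mathcal{A}\sum_{n=0}^{N-1}Z_n,\qquad \mathcal{C}=\exp\left[\frac{2j\pi}{N+1}\right],$$ where $j$ is the imaginary unit. Then the average outdoor-to-indoor SNR coverage probability (the probability that the SNR exceeds a threshold $T$) under this restriction is approximated, for thresholds of the form $T=k\mathcal{G}\mathcal{A}$ with $k$ an integer, $0\le k\le N$, by $$\Pr\left[\Gamma_{\mathrm{III}}>T\,\middle|\,T=k\mathcal{G}\mathcal{A}\right]>1-\sum_{q=0}^{k}\frac{1}{N+1}\sum_{\ell=0}^{N}\mathcal{C}^{-k\ell}\prod_{n=0}^{N-1}\left[1+(\mathcal{C}^{\ell}-1)(1-\mathfrak{p}_n)\right].$$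
   Context: A downlink signal from an outdoor base station with $M$ antennas reaches an indoor user through $N$ end-to-end paths, one through each of the $N$ sensors of a reconfigurable intelligent surface (RIS) built into the building wall. The $n$-th path is blocked when $Z_n=0$ and unblocked when $Z_n=1$. Here $Z_n=b^{\mathrm{out}}_n b^{\mathrm{in}}_n$ is the product of the outdoor and indoor Bernoulli blockage indicators, which equal $0$ (blocked) with probabilities $p_{\mathrm{out},n}$ and $p_{\mathrm{in},n}$ respectively, so that $\mathfrak{p}_n=p_{\mathrm{out},n}+p_{\mathrm{in},n}-p_{\mathrm{out},n}p_{\mathrm{in},n}$. Blockages of different paths are assumed independent. The constant is $\mathcal{G}=M^2L/\sigma_w^2$, with $L$ the outdoor large-scale path loss and $\sigma_w^2$ the noise variance. The coefficients are $\mathcal{A}_n=B_nG_b(\phi_n,\theta_n)|h_n|^2|g_n|^2$, where $B_n$ is the attenuation factor of the $n$-th sensor, $G_b(\phi_n,\theta_n)$ is the fraction of the peak beam power received by that sensor, lying in direction $(\phi_n,\theta_n)$ from the base station's reference antenna, and $h_n,g_n$ are the outdoor and indoor small-scale channel coefficients. The approximation replaces all $\mathcal{A}_n$ by the single average value $\mathcal{A}$; it is intended especially for small $N$, where a Gaussian (central limit) approximation of $\Gamma$ might not be applicable.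
   Formalization: The printed bound is false (k=0 gives equality; N=k=1 with p_0>1/2 violates it): the exponent C^{-kℓ} is corrected to C^{-qℓ} and the strict ">" to "=", with 𝒢>0 and 𝒜>0 made explicit. *)

theory Defs
  imports "HOL-Probability.Probability"
begin

definition snr :: "real \<Rightarrow> (nat \<Rightarrow> 'a \<Rightarrow> real) \<Rightarrow> nat \<Rightarrow> (nat \<Rightarrow> 'a \<Rightarrow> real) \<Rightarrow> 'a \<Rightarrow> real" where
  "snr G A N Z \<omega> = G * (\<Sum>n<N. A n \<omega> * Z n \<omega>)"

definition snr_III :: "real \<Rightarrow> real \<Rightarrow> nat \<Rightarrow> (nat \<Rightarrow> 'a \<Rightarrow> real) \<Rightarrow> 'a \<Rightarrow> real" where
  "snr_III G a N Z \<omega> = G * a * (\<Sum>n<N. Z n \<omega>)"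

text \<open>The restriction of the path coefficients to one fixed value turns the first SNR into
  the second.\<close>

lemma snr_const_coeff: "snr G (\<lambda>_ _. a) N Z = snr_III G a N Z"
  by (simp add: fun_eq_iff snr_def snr_III_def sum_distrib_left mult.assoc)

definition coverage_prob :: "'a measure \<Rightarrow> ('a \<Rightarrow> real) \<Rightarrow> real \<Rightarrow> real" where
  "coverage_prob P \<Gamma> T = measure P {\<omega> \<in> space P. \<Gamma> \<omega> > T}"

definition root_C :: "nat \<Rightarrow> complex" where
  "root_C N = exp (2 * \<i> * of_real pi / of_nat (N + 1))"

end

theory Submission
  imports Defs
begin

text \<open>Almost surely every \<open>Z n\<close> is 0 or 1, so the sum of the \<open>Z n\<close> is almost surely the number
  \<open>K\<close> of unblocked paths. Each factor \<open>1 + (C ^ l - 1) * (1 - p n)\<close> is the expectation of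
  \<open>C ^ (l * Z n)\<close>, so by independence the product is the characteristic value
  \<open>E [C ^ (l * K)]\<close>; orthogonality of the \<open>(N + 1)\<close>-st roots of unity inverts this discrete
  Fourier transform and yields \<open>P (K = q)\<close>.\<close>

lemma root_C_nonzero [simp]: "root_C N \<noteq> 0"
  by (simp add: root_C_def)

text \<open>This shape matches the library facts on complex roots of unity, which then decide
  equality of powers by congruence of exponents modulo \<open>Suc N\<close>.\<close>

lemma root_C_power: "root_C N ^ m = exp (2 * of_real pi * \<i> * of_nat m / of_nat (Suc N))"
  unfolding root_C_def exp_of_nat_mult [symmetric] by (simp add: field_simps)

lemma root_C_power_Suc [simp]: "root_C N ^ Suc N = 1"
  using complex_root_unity [of "Suc N" 1] complex_root_unity_eq [of "Suc N" "Suc N" 0]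
  unfolding root_C_power by (simp add: cong_def)

lemma root_C_power_inj:
  assumes "root_C N ^ m = root_C N ^ q" "m \<le> N" "q \<le> N"
  shows "m = q"
  using assms complex_root_unity_eq [of "Suc N" m q]
  unfolding root_C_power by (simp add: cong_def)

text \<open>A geometric sum whose ratio \<open>x\<close> is an (N + 1)-st root of unity: it vanishes
  unless \<open>x = 1\<close>. The bounds on \<open>m\<close> and \<open>q\<close> exclude distinct
  exponents that agree modulo \<open>N + 1\<close>.\<close>

lemma sum_root_C_orthogonal:
  assumes "m \<le> N" "q \<le> N"
  shows "(\<Sum>l=0..N. root_C N powi (- (int q * int l)) * (root_C N ^ l) ^ m)
    = (if m = q then of_nat (N + 1) else 0)"
proof -
  define x where "x = root_C N ^ m / root_C N ^ q"
  have "root_C N powi (- (int q * int l)) * (root_C N ^ l) ^ m = x ^ l" for l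
  proof -
    have "root_C N powi (- (int q * int l)) = inverse (root_C N ^ (q * l))"
      by (metis of_nat_mult power_int_minus power_int_of_nat)
    then have "root_C N powi (- (int q * int l)) * (root_C N ^ l) ^ m
        = root_C N ^ (l * m) / root_C N ^ (q * l)"
      by (simp add: power_mult divide_inverse)
    also have "\<dots> = x ^ l"
      unfolding x_def power_divide power_mult [symmetric] by (simp add: mult.commute)
    finally show ?thesis .
  qed
  then have sum_x: "(\<Sum>l=0..N. root_C N powi (- (int q * int l)) * (root_C N ^ l) ^ m)
      = (\<Sum>l<Suc N. x ^ l)"
    by (simp only: atLeast0AtMost lessThan_Suc_atMost)
  show ?thesis
  proof (cases "m = q")
    case True
    then have "x = 1" by (simp add: x_def)
    with True show ?thesis unfolding sum_x by simp
  next
    case False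
    then have "x \<noteq> 1"
      using root_C_power_inj [OF _ assms] by (auto simp: x_def)
    moreover have "x ^ Suc N = 1"
      by (metis root_C_power_Suc x_def power_divide power_mult mult.commute power_one div_by_1)
    ultimately have "(\<Sum>l<Suc N. x ^ l) = 0"
      by (simp del: sum.lessThan_Suc power_Suc add: geometric_sum)
    with False show ?thesis unfolding sum_x by simp
  qed
qed

context prob_space
begin

text \<open>The two disjoint level sets have total probability
  \<open>r + (1 - r) = 1\<close>.\<close>

lemma AE_zero_or_one:
  fixes X :: "'a \<Rightarrow> real"
  assumes [measurable]: "X \<in> borel_measurable M"
    and "prob {\<omega> \<in> space M. X \<omega> = 0} = r"
    and "prob {\<omega> \<in> space M. X \<omega> = 1} = 1 - r"
  shows "AE \<omega> in M. X \<omega> = 0 \<or> X \<omega> = 1"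
proof -
  have "prob ({\<omega> \<in> space M. X \<omega> = 0} \<union> {\<omega> \<in> space M. X \<omega> = 1})
      = prob {\<omega> \<in> space M. X \<omega> = 0} + prob {\<omega> \<in> space M. X \<omega> = 1}"
    by (rule finite_measure_Union) auto
  also have "\<dots> = 1" using assms by simp
  finally have "AE \<omega> in M. \<omega> \<in> {\<omega> \<in> space M. X \<omega> = 0} \<union> {\<omega> \<in> space M. X \<omega> = 1}"
    by (subst (asm) prob_eq_1) auto
  then show ?thesis by eventually_elim auto
qed

text \<open>The probability generating function of a Poisson binomial count. Counting ones, rather
  than summing the \<open>Z n\<close>, keeps the exponent a natural number at every point of the
  space.\<close>

lemma expectation_power_card_ones:
  fixes Z :: "nat \<Rightarrow> 'a \<Rightarrow> real" and c :: complex
  assumes indep: "indep_vars (\<lambda>_. borel) Z {..<N}"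
    and one: "\<And>n. n < N \<Longrightarrow> prob {\<omega> \<in> space M. Z n \<omega> = 1} = s n"
  shows "integrable M (\<lambda>\<omega>. c ^ card {n \<in> {..<N}. Z n \<omega> = 1})"
    and "expectation (\<lambda>\<omega>. c ^ card {n \<in> {..<N}. Z n \<omega> = 1})
      = (\<Prod>n<N. 1 + (c - 1) * of_real (s n))"
proof -
  \<comment> \<open>The power of \<open>c\<close> splits into the factors
    \<open>h (Z n \<omega>)\<close>, one per path, to which independence applies.\<close>
  define h where "h x = (if x = 1 then c else 1)" for x :: real
  have [measurable]: "h \<in> borel_measurable borel" unfolding h_def by measurable
  have meas [measurable]: "Z n \<in> borel_measurable M" if "n < N" for n
    using indep that by (auto simp: indep_vars_def)
  have ind: "indep_vars (\<lambda>_. borel) (\<lambda>n \<omega>. h (Z n \<omega>)) {..<N}"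
    by (rule indep_vars_compose2 [OF indep]) simp
  \<comment> \<open>Being affine in an indicator, \<open>h\<close> has an expectation that is affine
    in the probability \<open>s n\<close>.\<close>
  have h_eq: "h x = 1 + (c - 1) * of_real (indicator {1} x)" for x
    by (auto simp: h_def)
  have step: "integrable M (\<lambda>\<omega>. h (Z n \<omega>)) \<and>
      expectation (\<lambda>\<omega>. h (Z n \<omega>)) = 1 + (c - 1) * of_real (s n)" if "n < N" for n
  proof -
    note meas [OF that, measurable]
    have ind_eq: "indicator {1} (Z n \<omega>) = (indicator {\<omega> \<in> space M. Z n \<omega> = 1} \<omega> :: real)"
      if "\<omega> \<in> space M" for \<omega>
      using that by (auto simp: indicator_def)
    have "integrable M (\<lambda>\<omega>. indicator {1} (Z n \<omega>) :: real)"
      by (rule integrable_const_bound [where B = 1]) (auto simp: indicator_def)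
    moreover have "expectation (\<lambda>\<omega>. indicator {1} (Z n \<omega>) :: real) = s n"
      using ind_eq one [OF that]
      by (subst Bochner_Integration.integral_cong [OF refl]) auto
    ultimately show ?thesis
      unfolding h_eq by (simp add: prob_space)
  qed
  have prod_eq: "(\<Prod>n<N. h (Z n \<omega>)) = c ^ card {n \<in> {..<N}. Z n \<omega> = 1}" for \<omega>
    unfolding h_def by (simp add: prod.If_cases Int_def)
  show "integrable M (\<lambda>\<omega>. c ^ card {n \<in> {..<N}. Z n \<omega> = 1})"
    using indep_vars_integrable [OF _ ind] step unfolding prod_eq by simp
  show "expectation (\<lambda>\<omega>. c ^ card {n \<in> {..<N}. Z n \<omega> = 1})
      = (\<Prod>n<N. 1 + (c - 1) * of_real (s n))"
    using indep_vars_lebesgue_integral [OF _ ind] step unfolding prod_eq by simp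
qed

text \<open>Fourier inversion on the cyclic group of order \<open>N + 1\<close>, the number of
  values 0, ..., N that the count can take.\<close>

lemma prob_card_ones_eq:
  fixes Z :: "nat \<Rightarrow> 'a \<Rightarrow> real"
  assumes indep: "indep_vars (\<lambda>_. borel) Z {..<N}"
    and one: "\<And>n. n < N \<Longrightarrow> prob {\<omega> \<in> space M. Z n \<omega> = 1} = s n"
    and q: "q \<le> N"
  shows "complex_of_real (prob {\<omega> \<in> space M. card {n \<in> {..<N}. Z n \<omega> = 1} = q}) =
    1 / of_nat (N + 1) * (\<Sum>l=0..N. root_C N powi (- (int q * int l)) *
      (\<Prod>n<N. 1 + (root_C N ^ l - 1) * of_real (s n)))"
proof -
  define K where "K \<omega> = card {n \<in> {..<N}. Z n \<omega> = 1}" for \<omega>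
  have K_le: "K \<omega> \<le> N" for \<omega>
    using card_mono [of "{..<N}" "{n \<in> {..<N}. Z n \<omega> = 1}"] by (auto simp: K_def)
  note E = expectation_power_card_ones [OF indep one, folded K_def]
  have "(\<Sum>l=0..N. root_C N powi (- (int q * int l)) *
      (\<Prod>n<N. 1 + (root_C N ^ l - 1) * of_real (s n)))
    = expectation (\<lambda>\<omega>. \<Sum>l=0..N. root_C N powi (- (int q * int l)) * (root_C N ^ l) ^ K \<omega>)"
    using E by simp
  \<comment> \<open>Orthogonality is applied pointwise, with \<open>m = K \<omega>\<close>.\<close>
  also have "\<dots> = expectation (\<lambda>\<omega>. of_nat (N + 1) *
      complex_of_real (indicator {\<omega> \<in> space M. K \<omega> = q} \<omega>))"
    by (rule Bochner_Integration.integral_cong)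
       (auto simp: sum_root_C_orthogonal [OF K_le q] indicator_def)
  also have "\<dots> = of_nat (N + 1) * complex_of_real (prob {\<omega> \<in> space M. K \<omega> = q})"
    by (simp add: Int_def conj_commute cong: conj_cong)
  finally show ?thesis
    unfolding K_def [symmetric] by (simp del: of_nat_add of_nat_Suc)
qed

end

text \<open>Equality holds because the event is, up to a null set, that more than \<open>k\<close>
  paths are unblocked. The exponent carries the summation index \<open>q\<close>, so that each
  summand is the probability of exactly \<open>q\<close> unblocked paths; with \<open>k\<close>
  there, all summands would coincide.\<close>

theorem proposition2:
  fixes P :: "'a measure"
    and N k :: nat
    and Z \<A> :: "nat \<Rightarrow> 'a \<Rightarrow> real"
    and p :: "nat \<Rightarrow> real"
    and G a T :: real
  assumes "prob_space P"
    and "prob_space.indep_vars P (\<lambda>_. borel) Z {..<N}"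
    and "\<And>n. n < N \<Longrightarrow> measure P {\<omega> \<in> space P. Z n \<omega> = 0} = p n"
    and "\<And>n. n < N \<Longrightarrow> measure P {\<omega> \<in> space P. Z n \<omega> = 1} = 1 - p n"
    and "\<And>n. n < N \<Longrightarrow> integrable P (\<A> n)"
    and "\<And>n. n < N \<Longrightarrow> a = prob_space.expectation P (\<A> n)"
    and "G > 0" and "a > 0"
    and "k \<le> N"
    and "T = real k * G * a"
  shows "complex_of_real (coverage_prob P (snr_III G a N Z) T) =
    1 - (\<Sum>q=0..k. 1 / of_nat (N + 1) *
          (\<Sum>l=0..N. root_C N powi (- (int q * int l)) *
            (\<Prod>n<N. 1 + (root_C N ^ l - 1) * (1 - of_real (p n)))))"
proof -
  interpret prob_space P by fact
  define K where "K \<omega> = card {n \<in> {..<N}. Z n \<omega> = 1}" for \<omega>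
  have meas [measurable]: "Z n \<in> borel_measurable P" if "n < N" for n
    using assms(2) that by (auto simp: indep_vars_def)
  \<comment> \<open>Written as a finite sum of measurable terms, \<open>K\<close> is seen to be
    measurable.\<close>
  have K_sum: "K \<omega> = (\<Sum>n<N. if Z n \<omega> = 1 then 1 else 0)" for \<omega>
    by (simp add: K_def sum.If_cases Int_def)
  have [measurable]: "K \<in> measurable P (count_space UNIV)"
    unfolding K_sum [abs_def] by measurable
  have [measurable]: "snr_III G a N Z \<in> borel_measurable P"
    unfolding snr_III_def [abs_def] by measurable
  have "AE \<omega> in P. \<forall>n\<in>{..<N}. Z n \<omega> = 0 \<or> Z n \<omega> = 1"
    using AE_zero_or_one [OF meas assms(3,4)] by (intro AE_finite_allI) auto
  then have "AE \<omega> in P. (snr_III G a N Z \<omega> > T) = (\<not> K \<omega> \<le> k)"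
  proof eventually_elim
    case (elim \<omega>)
    then have "(\<Sum>n<N. Z n \<omega>) = (\<Sum>n<N. if Z n \<omega> = 1 then 1 else 0)"
      by (intro sum.cong) auto
    also have "\<dots> = real (K \<omega>)"
      by (simp add: K_sum of_nat_sum if_distrib cong: if_cong)
    finally show ?case
      \<comment> \<open>Since \<open>G * a > 0\<close>, this factor cancels from both sides, leaving
        \<open>K \<omega> > k\<close>.\<close>
      using assms(7,8,10) by (simp add: snr_III_def mult.commute not_le)
  qed
  then have "coverage_prob P (snr_III G a N Z) T = prob {\<omega> \<in> space P. \<not> K \<omega> \<le> k}"
    unfolding coverage_prob_def by (intro finite_measure_eq_AE) auto
  also have "\<dots> = 1 - prob {\<omega> \<in> space P. K \<omega> \<le> k}"
    by (intro prob_neg) measurable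
  also have "{\<omega> \<in> space P. K \<omega> \<le> k} = (\<Union>q\<in>{0..k}. {\<omega> \<in> space P. K \<omega> = q})"
    by auto
  also have "prob \<dots> = (\<Sum>q=0..k. prob {\<omega> \<in> space P. K \<omega> = q})"
    by (intro finite_measure_finite_Union) (auto simp: disjoint_family_on_def)
  finally have "complex_of_real (coverage_prob P (snr_III G a N Z) T)
      = 1 - (\<Sum>q=0..k. complex_of_real (prob {\<omega> \<in> space P. K \<omega> = q}))"
    by simp
  also have "(\<Sum>q=0..k. complex_of_real (prob {\<omega> \<in> space P. K \<omega> = q})) =
      (\<Sum>q=0..k. 1 / of_nat (N + 1) *
        (\<Sum>l=0..N. root_C N powi (- (int q * int l)) *
          (\<Prod>n<N. 1 + (root_C N ^ l - 1) * (1 - of_real (p n)))))"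
    using prob_card_ones_eq [OF assms(2,4)] assms(9)
    by (intro sum.cong) (auto simp: K_def)
  finally show ?thesis .
qed

end
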